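(* Let $A \in \mathbb{C}^{m \times n}$, $W \in \mathbb{C}^{n \times m}$ and $r=r(A)$. Then $$A\{1',2',3'\} =\{Y((WAWY)^*WAWY)^{-1}(WAWY)^* \mid Y \in \mathbb{C}^{m \times r}_r,\ r(WAWY)=r(Y)=r(A) \}$$ $$= \{Y(WAWY)^{\dagger} \mid Y \in \mathbb{C}^{m \times r}_r, \ r(WAWY)=r(Y)=r(A) \}$$ and $$A\{1',2',4'\} =\{(YWAW)^*(YWAW(YWAW)^* )^{-1}Y \mid Y \in \mathbb{C}^{r \times m}_r... \}$$ in the following precise form, with $Y$ of size $r\times n$: $$A\{1',2',4'\} =\{(YWAW)^*(YWAW(YWAW)^* )^{-1}Y \mid Y \in \mathbb{C}^{r \times n}_r,\ r(YWAW)=r(Y)=r(A) \}= \{(YWAW)^{\dagger}Y \mid Y \in \mathbb{C}^{r \times n}_r, \ r(YWAW)=r(Y)=r(A) \}.$$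
   Context: $r(\cdot)$ denotes rank, $*$ conjugate transpose, $M^\dagger$ the Moore-Penrose inverse of $M$, and $\mathbb{C}^{p\times q}_r$ the set of complex $p \times q$ matrices of rank $r$. For $A \in \mathbb{C}^{m \times n}$, $W \in \mathbb{C}^{n \times m}$: $A\{1',2',3'\}$ is the set of all $X \in \mathbb{C}^{m \times n}$ with $AWXWA=A$, $XWAWX=X$ and $(WAWX)^*=WAWX$; $A\{1',2',4'\}$ is the set of all $X \in \mathbb{C}^{m \times n}$ with $AWXWA=A$, $XWAWX=X$ and $(XWAW)^*=XWAW$. *)

theory Defs
  imports
    "Jordan_Normal_Form.DL_Rank"
    "Jordan_Normal_Form.Schur_Decomposition"
    "Jordan_Normal_Form.Gauss_Jordan_Elimination"
begin

abbreviation mat_rank :: "complex mat \<Rightarrow> nat" where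
  "mat_rank A \<equiv> vec_space.rank (dim_row A) A"

definition carrier_mat_rank :: "nat \<Rightarrow> nat \<Rightarrow> nat \<Rightarrow> complex mat set" where
  "carrier_mat_rank p q r = {M \<in> carrier_mat p q. mat_rank M = r}"

text \<open>Unspecified when the matrix is not invertible.\<close>
abbreviation mat_inv :: "complex mat \<Rightarrow> complex mat" where
  "mat_inv A \<equiv> the (mat_inverse A)"

definition is_moore_penrose :: "complex mat \<Rightarrow> complex mat \<Rightarrow> bool" where
  "is_moore_penrose M X \<longleftrightarrow>
     X \<in> carrier_mat (dim_col M) (dim_row M) \<and>
     M * X * M = M \<and>
     X * M * X = X \<and>
     mat_adjoint (M * X) = M * X \<and>
     mat_adjoint (X * M) = X * M"

definition moore_penrose :: "complex mat \<Rightarrow> complex mat" where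
  "moore_penrose M = (THE X. is_moore_penrose M X)"

text \<open>The sets $A\{1',2',3'\}$ and $A\{1',2',4'\}$ depend on the weight $W$, which the
  traditional notation suppresses.  Note that the elements have the size of $A$, not of its
  transpose.\<close>

definition weighted_123_inverses :: "complex mat \<Rightarrow> complex mat \<Rightarrow> complex mat set" where
  "weighted_123_inverses A W = {X \<in> carrier_mat (dim_row A) (dim_col A).
     A * W * X * W * A = A \<and>
     X * W * A * W * X = X \<and>
     mat_adjoint (W * A * W * X) = W * A * W * X}"

definition weighted_124_inverses :: "complex mat \<Rightarrow> complex mat \<Rightarrow> complex mat set" where
  "weighted_124_inverses A W = {X \<in> carrier_mat (dim_row A) (dim_col A).
     A * W * X * W * A = A \<and>
     X * W * A * W * X = X \<and>
     mat_adjoint (X * W * A * W) = X * W * A * W}"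

end

theory Submission
  imports Defs
begin

text \<open>Write \<open>M = WAW\<close>. Any \<open>X\<close> in \<open>A{1',2',3'}\<close> has rank \<open>r = r(A)\<close>, so \<open>X = YZ\<close> with \<open>Y\<close> of full
  column rank and \<open>Z\<close> of full row rank; cancelling \<open>Y\<close> and \<open>Z\<close> in \<open>XMX = X\<close> gives \<open>ZMY = 1\<close>, and since
  \<open>MYZ = MX\<close> is Hermitian, \<open>Z\<close> is the Moore-Penrose inverse of \<open>MY\<close>. Conversely, let \<open>X = YZ\<close> where
  \<open>Z\<close> is the Moore-Penrose inverse of \<open>MY\<close> of rank \<open>r\<close>, and let \<open>A = BD\<close> be a full rank factorization.
  Then \<open>1 = ZMY = (ZWB)(DWY)\<close> with square factors, so \<open>(DWY)(ZWB) = 1\<close>, which is exactly what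
  \<open>AWXWA = B(DWY)(ZWB)D = A\<close> needs. The statement for \<open>A{1',2',4'}\<close> follows by taking adjoints.\<close>

section \<open>Rank factorizations and ranks of products\<close>

text \<open>Take a maximal linearly independent set of columns of \<open>A\<close> as the columns of
  \<open>B\<close>. By maximality every column of \<open>A\<close> lies in their span, and its
  coordinates form the corresponding column of \<open>C\<close>.\<close>

lemma (in vec_space) rank_factorization:
  assumes A: "A \<in> carrier_mat n nc"
  obtains B C where "B \<in> carrier_mat n (rank A)" "C \<in> carrier_mat (rank A) nc" "A = B * C"
proof -
  have colsA: "set (cols A) \<subseteq> carrier_vec n"
    using A cols_dim by blast
  obtain S where S: "finite S" "maximal S (\<lambda>T. T \<subseteq> set (cols A) \<and> lin_indpt T)"
    using maximal_exists_superset[of "set (cols A)" "\<lambda>T. T \<subseteq> set (cols A) \<and> lin_indpt T" "{}"]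
    by (auto simp: finite_lin_indpt2)
  then have SA: "S \<subseteq> set (cols A)" and li: "lin_indpt S"
    by (auto simp: maximal_def)
  have SV: "S \<subseteq> carrier_vec n"
    using SA colsA by blast
  have in_span: "v \<in> span S" if v: "v \<in> set (cols A)" for v
  proof (rule ccontr)
    assume nv: "v \<notin> span S"
    then have "v \<notin> S"
      using SV span_mem by auto
    moreover have "lin_indpt (S \<union> {v})"
      using lin_dep_iff_in_span[OF _ li, of v] SV nv v colsA \<open>v \<notin> S\<close> by auto
    ultimately show False
      using S(2) v SA by (auto simp: maximal_def)
  qed
  obtain xs where xs: "set xs = S" "distinct xs"
    using finite_distinct_list[OF S(1)] by blast
  define B where "B = mat_of_cols n xs"
  have "length xs = rank A"
    using rank_card_indpt[OF A S(2)] xs distinct_card by fastforce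
  then have B: "B \<in> carrier_mat n (rank A)"
    by (auto simp: B_def)
  have "cols B = xs"
    unfolding B_def using xs SV by (intro cols_mat_of_cols) auto
  then have col_space: "col_space B = span S"
    by (simp add: col_space_def xs(1))
  have "\<exists>x \<in> carrier_vec (rank A). B *\<^sub>v x = col A j" if "j < nc" for j
  proof -
    have "col A j \<in> col_space B"
      unfolding col_space using that A by (intro in_span) (simp add: cols_def)
    then show ?thesis
      unfolding col_space_eq[OF B] using B by auto
  qed
  then obtain x where x: "\<And>j. j < nc \<Longrightarrow> x j \<in> carrier_vec (rank A) \<and> B *\<^sub>v x j = col A j"
    by metis
  define C where "C = mat_of_cols (rank A) (map x [0..<nc])"
  have C: "C \<in> carrier_mat (rank A) nc"
    by (simp add: C_def mat_of_cols_def)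
  have colC: "col C j = x j" if "j < nc" for j
    unfolding C_def using that x by (subst col_mat_of_cols) auto
  have "A = B * C"
  proof (rule mat_col_eqI)
    fix j assume "j < dim_col (B * C)"
    then have j: "j < nc" using C by auto
    then show "col A j = col (B * C) j"
      using col_mult2[OF B C j] x[OF j] colC[OF j] by simp
  qed (use A B C in auto)
  with B C show thesis by (rule that)
qed

text \<open>The columns of \<open>B * C\<close> lie in the column space of \<open>B\<close>, which
  is spanned by at most \<open>k\<close> vectors, so Steinitz exchange (\<open>replacement\<close>)
  bounds every independent set of them.\<close>

lemma (in vec_space) rank_mult_le:
  assumes B: "B \<in> carrier_mat n k" and C: "C \<in> carrier_mat k nc"
  shows "rank (B * C) \<le> k"
proof -
  have A: "B * C \<in> carrier_mat n nc"
    using B C by simp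
  obtain S where S: "finite S" "maximal S (\<lambda>T. T \<subseteq> set (cols (B * C)) \<and> lin_indpt T)"
    using maximal_exists_superset[of "set (cols (B * C))"
        "\<lambda>T. T \<subseteq> set (cols (B * C)) \<and> lin_indpt T" "{}"]
    by (auto simp: finite_lin_indpt2)
  have colsB: "set (cols B) \<subseteq> carrier_vec n"
    using B cols_dim by blast
  have "v \<in> col_space B" if v: "v \<in> set (cols (B * C))" for v
  proof -
    from v obtain j where j: "j < nc" "v = col (B * C) j"
      using C by (auto simp: cols_def)
    then have "v = B *\<^sub>v col C j"
      using col_mult2[OF B C] by simp
    then show ?thesis
      using B C j by (auto simp: col_space_eq[OF B])
  qed
  then have "S \<subseteq> span (set (cols B))"
    using S(2) by (auto simp: maximal_def col_space_def)
  moreover have "lin_indpt S"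
    using S(2) by (auto simp: maximal_def)
  ultimately have "card S \<le> card (set (cols B))"
    using replacement[OF S(1), of "set (cols B)"] colsB by force
  also have "\<dots> \<le> k"
    using card_length[of "cols B"] B by simp
  finally show ?thesis
    using rank_card_indpt[OF A S(2)] by simp
qed

text \<open>A rank factorization of \<open>A\<close> makes \<open>A * B\<close> factor through the
  inner dimension r(A), so the preceding bound applies.\<close>

lemma rank_mult_le_left:
  fixes A B :: "'a :: field mat"
  assumes A: "A \<in> carrier_mat n k" and B: "B \<in> carrier_mat k nc"
  shows "vec_space.rank n (A * B) \<le> vec_space.rank n A"
proof -
  obtain C D where C: "C \<in> carrier_mat n (vec_space.rank n A)"
      and D: "D \<in> carrier_mat (vec_space.rank n A) k" and ACD: "A = C * D"
    using vec_space.rank_factorization[OF A] .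
  have "A * B = C * (D * B)"
    by (subst ACD) (rule assoc_mult_mat[OF C D B])
  also have "vec_space.rank n \<dots> \<le> vec_space.rank n A"
    using C mult_carrier_mat[OF D B] by (rule vec_space.rank_mult_le)
  finally show ?thesis .
qed

lemma rank_mult_le_right:
  fixes A B :: "'a :: field mat"
  assumes A: "A \<in> carrier_mat n k" and B: "B \<in> carrier_mat k nc"
  shows "vec_space.rank n (A * B) \<le> vec_space.rank k B"
proof -
  obtain C D where C: "C \<in> carrier_mat k (vec_space.rank k B)"
      and D: "D \<in> carrier_mat (vec_space.rank k B) nc" and BCD: "B = C * D"
    using vec_space.rank_factorization[OF B] .
  have "A * B = (A * C) * D"
    by (subst BCD) (rule assoc_mult_mat[OF A C D, symmetric])
  also have "vec_space.rank n \<dots> \<le> vec_space.rank k B"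
    using mult_carrier_mat[OF A C] D by (rule vec_space.rank_mult_le)
  finally show ?thesis .
qed

section \<open>The conjugate transpose\<close>

lemma dim_row_mat_adjoint [simp]: "dim_row (mat_adjoint A) = dim_col A"
  by (simp add: mat_adjoint_def)

lemma dim_col_mat_adjoint [simp]: "dim_col (mat_adjoint A) = dim_row A"
  by (simp add: mat_adjoint_def)

lemma mat_adjoint_carrier [simp]:
  "mat_adjoint A \<in> carrier_mat n m \<longleftrightarrow> A \<in> carrier_mat m n"
  unfolding carrier_mat_def by auto

lemma index_mat_adjoint [simp]:
  "i < dim_col A \<Longrightarrow> j < dim_row A \<Longrightarrow> mat_adjoint A $$ (i, j) = conjugate (A $$ (j, i))"
  by (simp add: mat_adjoint_def mat_of_rows_index)

lemma mat_adjoint_adjoint [simp]: "mat_adjoint (mat_adjoint A) = A"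
  by (rule eq_matI) simp_all

lemma mat_adjoint_one [simp]: "mat_adjoint (1\<^sub>m n :: complex mat) = 1\<^sub>m n"
  by (rule eq_matI) simp_all

lemma mat_adjoint_mult:
  assumes A: "A \<in> carrier_mat n k" and B: "B \<in> carrier_mat k m"
  shows "mat_adjoint (A * B) = mat_adjoint B * mat_adjoint A"
proof (rule eq_matI)
  fix i j assume "i < dim_row (mat_adjoint B * mat_adjoint A)"
    "j < dim_col (mat_adjoint B * mat_adjoint A)"
  then have i: "i < m" and j: "j < n"
    using A B by simp_all
  have "mat_adjoint (A * B) $$ (i, j) = conjugate (\<Sum>l<k. A $$ (j, l) * B $$ (l, i))"
    using A B i j by (simp add: scalar_prod_def atLeast0LessThan)
  also have "\<dots> = (\<Sum>l<k. conjugate (B $$ (l, i)) * conjugate (A $$ (j, l)))"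
    by (simp add: sum_conjugate conjugate_dist_mul mult.commute)
  also have "\<dots> = (mat_adjoint B * mat_adjoint A) $$ (i, j)"
    using A B i j by (simp add: scalar_prod_def atLeast0LessThan)
  finally show "mat_adjoint (A * B) $$ (i, j) = (mat_adjoint B * mat_adjoint A) $$ (i, j)" .
qed (use A B in simp_all)

text \<open>The adjoint of a rank factorization factors \<open>mat_adjoint A\<close> through the
  same inner dimension. Applying this twice yields equality of the ranks.\<close>

lemma rank_mat_adjoint_le:
  assumes A: "A \<in> carrier_mat n m"
  shows "vec_space.rank m (mat_adjoint A) \<le> vec_space.rank n A"
proof -
  obtain C D where CD: "C \<in> carrier_mat n (vec_space.rank n A)"
      "D \<in> carrier_mat (vec_space.rank n A) m" "A = C * D"
    using vec_space.rank_factorization[OF A] .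
  then have "mat_adjoint A = mat_adjoint D * mat_adjoint C"
    by (metis mat_adjoint_mult)
  then show ?thesis
    using vec_space.rank_mult_le[of "mat_adjoint D" m _ "mat_adjoint C" n] CD by simp
qed

lemma rank_mat_adjoint:
  assumes "A \<in> carrier_mat n m"
  shows "vec_space.rank m (mat_adjoint A) = vec_space.rank n A"
  using rank_mat_adjoint_le[OF assms] rank_mat_adjoint_le[of "mat_adjoint A" m n] assms
  by simp

section \<open>Full column rank and Gram matrices\<close>

text \<open>The identity of rank \<open>r\<close> factors through \<open>Y\<close>, which forces the
  rank of \<open>Y\<close> up to its number of columns.\<close>

lemma rank_if_left_inverse:
  fixes Y :: "'a :: field mat"
  assumes Y: "Y \<in> carrier_mat n r" and L: "L \<in> carrier_mat r n" and "L * Y = 1\<^sub>m r"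
  shows "vec_space.rank n Y = r"
proof (rule antisym)
  show "vec_space.rank n Y \<le> r"
    using vec_space.rank_le_nc[OF Y] .
  have "vec_space.rank r (1\<^sub>m r :: 'a mat) = r"
    using vec_space.det_rank_iff[of "1\<^sub>m r :: 'a mat" r] by simp
  then show "r \<le> vec_space.rank n Y"
    using rank_mult_le_right[OF L Y] assms(3) by simp
qed

text \<open>Linear independence is a property of the set of columns, so a repeated column would
  leave fewer than \<open>nc\<close> vectors to choose from. Distinctness lets a nonzero kernel
  vector be turned into a dependence of that set.\<close>

lemma (in vec_space) full_rank_distinct_cols:
  assumes A: "A \<in> carrier_mat n nc" and "rank A = nc"
  shows "distinct (cols A)"
proof -
  obtain S where S: "finite S" "maximal S (\<lambda>T. T \<subseteq> set (cols A) \<and> lin_indpt T)"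
    using maximal_exists_superset[of "set (cols A)" "\<lambda>T. T \<subseteq> set (cols A) \<and> lin_indpt T" "{}"]
    by (auto simp: finite_lin_indpt2)
  then have "nc = card S" "card S \<le> card (set (cols A))"
    using rank_card_indpt[OF A S(2)] assms(2) by (auto simp: maximal_def card_mono)
  then show ?thesis
    using A card_length[of "cols A"] by (intro card_distinct) auto
qed

text \<open>If the Gram matrix kills a nonzero \<open>v\<close>, then the squared norm of
  \<open>Yv\<close> is zero, so \<open>Yv\<close> = 0, against the independence of the columns of
  \<open>Y\<close>.\<close>

lemma gram_det_nonzero:
  fixes Y :: "complex mat"
  assumes Y: "Y \<in> carrier_mat n r" and rank: "vec_space.rank n Y = r"
  shows "det (mat_adjoint Y * Y) \<noteq> 0"
proof
  assume "det (mat_adjoint Y * Y) = 0"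
  then obtain v where v: "v \<in> carrier_vec r" "v \<noteq> 0\<^sub>v r" "(mat_adjoint Y * Y) *\<^sub>v v = 0\<^sub>v r"
    using det_0_iff_vec_prod_zero_field[of "mat_adjoint Y * Y" r] Y by auto
  define u where "u = Y *\<^sub>v v"
  have u: "u \<in> carrier_vec n"
    using Y v by (simp add: u_def)
  have *: "mat_adjoint Y *\<^sub>v u = 0\<^sub>v r"
    using v Y by (simp add: u_def assoc_mult_mat_vec[of _ r n _ r])
  \<comment> \<open>The scalar product is bilinear, so moving \<open>Y\<close> to the other side
    gives its transpose acting on \<open>conjugate u\<close>, which is the conjugate of
    \<open>mat_adjoint Y *\<^sub>v u\<close> and hence zero.\<close>
  have "u \<bullet> conjugate u = conjugate u \<bullet> (Y *\<^sub>v v)"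
    using u by (metis u_def carrier_vec_conjugate comm_scalar_prod)
  also have "\<dots> = (Y\<^sup>T *\<^sub>v conjugate u) \<bullet> v"
    using Y u v by (subst transpose_vec_mult_scalar) auto
  also have "Y\<^sup>T *\<^sub>v conjugate u = conjugate (mat_adjoint Y *\<^sub>v u)"
    using Y u by (intro eq_vecI)
      (auto simp: scalar_prod_def sum_conjugate conjugate_dist_mul intro!: sum.cong)
  finally have "u = 0\<^sub>v n"
    using * u v by (simp add: conjugate_square_eq_0_vec)
  then have "module.lin_dep class_ring (module_vec TYPE(complex) n) (set (cols Y))"
    using vec_space.lin_depI[OF Y v(1,2)] vec_space.full_rank_distinct_cols[OF Y rank]
    by (simp add: u_def)
  moreover have "\<not> module.lin_dep class_ring (module_vec TYPE(complex) n) (set (cols Y))"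
    using vec_space.full_rank_lin_indpt[OF Y rank] vec_space.full_rank_distinct_cols[OF Y rank]
    by simp
  ultimately show False by simp
qed

section \<open>Inverses of square matrices and product rules\<close>

lemma mat_inv_mult:
  assumes A: "A \<in> carrier_mat n n" and det: "det A \<noteq> 0"
  shows "mat_inv A \<in> carrier_mat n n" "A * mat_inv A = 1\<^sub>m n" "mat_inv A * A = 1\<^sub>m n"
proof -
  obtain B where "mat_inverse A = Some B"
    \<comment> \<open>\<open>undefined\<close> fills the record extension slot of
      \<open>ring_mat\<close>, so that both facts speak of units of the same ring.\<close>
    using mat_inverse(1)[OF A, of undefined] det_non_zero_imp_unit[OF A det, of undefined]
    by (cases "mat_inverse A") auto
  then show "mat_inv A \<in> carrier_mat n n" "A * mat_inv A = 1\<^sub>m n" "mat_inv A * A = 1\<^sub>m n"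
    using mat_inverse(2)[OF A] by auto
qed

lemma invertible_mat_if_det_nonzero:
  fixes A :: "complex mat"
  assumes A: "A \<in> carrier_mat n n" and det: "det A \<noteq> 0"
  shows "invertible_mat A"
proof -
  have "A * mat_inv A = 1\<^sub>m (dim_row A)" "mat_inv A * A = 1\<^sub>m (dim_row (mat_inv A))"
    using mat_inv_mult[OF assms] A by simp_all
  then show ?thesis
    using A unfolding invertible_mat_def inverts_mat_def by auto
qed

text \<open>The side conditions are equations between dimensions, which the simplifier can
  discharge; as a rewrite rule it nests products to the right.\<close>

lemma mult_mat_assoc_dim:
  fixes A B C :: "'a :: semiring_0 mat"
  assumes "dim_col A = dim_row B" "dim_col B = dim_row C"
  shows "A * B * C = A * (B * C)"
  using assms by (intro assoc_mult_mat[of _ "dim_row A" "dim_col A" _ "dim_col B" _ "dim_col C"]) auto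

lemma mat_adjoint_mult_dim:
  "dim_col A = dim_row B \<Longrightarrow> mat_adjoint (A * B) = mat_adjoint B * mat_adjoint A"
  by (rule mat_adjoint_mult) auto

text \<open>Taking adjoints in \<open>A * mat_inv A = 1\<^sub>m n\<close> shows that the adjoint of
  the inverse is a left inverse of \<open>A\<close>, and a left inverse equals the right
  inverse.\<close>

lemma mat_inv_hermitian:
  fixes A :: "complex mat"
  assumes A: "A \<in> carrier_mat n n" and det: "det A \<noteq> 0" and herm: "mat_adjoint A = A"
  shows "mat_adjoint (mat_inv A) = mat_inv A"
proof -
  note inv = mat_inv_mult[OF A det]
  have adj: "mat_adjoint (mat_inv A) \<in> carrier_mat n n"
    using inv(1) by simp
  have "mat_adjoint (mat_inv A) * A = 1\<^sub>m n"
    using arg_cong[OF inv(2), of mat_adjoint] mat_adjoint_mult[OF A inv(1)] herm by simp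
  then have "mat_inv A = (mat_adjoint (mat_inv A) * A) * mat_inv A"
    using inv(1) by simp
  also have "\<dots> = mat_adjoint (mat_inv A) * (A * mat_inv A)"
    by (rule assoc_mult_mat[OF adj A inv(1)])
  also have "\<dots> = mat_adjoint (mat_inv A)"
    using adj by (simp add: inv(2))
  finally show ?thesis by simp
qed

section \<open>The Moore-Penrose inverse\<close>

text \<open>\<open>M * X\<close> and \<open>M * Y\<close> are Hermitian projections onto the column
  space of \<open>M\<close>, hence equal; dually \<open>X * M = Y * M\<close>. Then X = XMX = YMX =
  YMY = Y.\<close>

lemma is_moore_penrose_unique:
  assumes X: "is_moore_penrose M X" and Y: "is_moore_penrose M Y"
  shows "X = Y"
proof -
  have dims [simp]: "dim_row X = dim_col M" "dim_col X = dim_row M"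
      "dim_row Y = dim_col M" "dim_col Y = dim_row M"
    using X Y by (auto simp: is_moore_penrose_def)
  have MX: "mat_adjoint (M * X) = M * X" and XM: "mat_adjoint (X * M) = X * M"
    and MY: "mat_adjoint (M * Y) = M * Y" and YM: "mat_adjoint (Y * M) = Y * M"
    and MXM: "M * X * M = M" and MYM: "M * Y * M = M"
    and XMX: "X * M * X = X" and YMY: "Y * M * Y = Y"
    using X Y by (auto simp: is_moore_penrose_def)
  have "M * X = (M * Y) * (M * X)"
    using arg_cong[OF MYM, of "\<lambda>T. T * X"] by (simp add: mult_mat_assoc_dim)
  from arg_cong[OF this, of mat_adjoint] have "M * X = (M * X) * (M * Y)"
    by (simp add: mat_adjoint_mult_dim[of "M * Y" "M * X"] MX MY)
  also have "\<dots> = M * Y"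
    using arg_cong[OF MXM, of "\<lambda>T. T * Y"] by (simp add: mult_mat_assoc_dim)
  finally have 1: "M * X = M * Y" .
  have "X * M = (X * M) * (Y * M)"
    using arg_cong[OF MYM, of "\<lambda>T. X * T"] by (simp add: mult_mat_assoc_dim)
  from arg_cong[OF this, of mat_adjoint] have "X * M = (Y * M) * (X * M)"
    by (simp add: mat_adjoint_mult_dim[of "X * M" "Y * M"] XM YM)
  also have "\<dots> = Y * M"
    using arg_cong[OF MXM, of "\<lambda>T. Y * T"] by (simp add: mult_mat_assoc_dim)
  finally have 2: "X * M = Y * M" .
  have "X = Y * M * X"
    using XMX 2 by simp
  also have "\<dots> = Y * (M * Y)"
    by (simp add: mult_mat_assoc_dim 1)
  also have "\<dots> = Y"
    using YMY by (simp add: mult_mat_assoc_dim)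
  finally show ?thesis .
qed

lemma moore_penrose_eqI: "is_moore_penrose M X \<Longrightarrow> moore_penrose M = X"
  unfolding moore_penrose_def using is_moore_penrose_unique by blast

text \<open>Adjoints preserve each of the first two Penrose equations and interchange the two
  Hermitian conditions.\<close>

lemma is_moore_penrose_adjoint:
  assumes "is_moore_penrose M X"
  shows "is_moore_penrose (mat_adjoint M) (mat_adjoint X)"
proof -
  have dims [simp]: "dim_row X = dim_col M" "dim_col X = dim_row M"
    using assms by (auto simp: is_moore_penrose_def)
  have X: "M * X * M = M" "X * M * X = X" "mat_adjoint (M * X) = M * X" "mat_adjoint (X * M) = X * M"
    using assms by (auto simp: is_moore_penrose_def)
  have "mat_adjoint M * mat_adjoint X * mat_adjoint M = mat_adjoint (M * X * M)"
    "mat_adjoint X * mat_adjoint M * mat_adjoint X = mat_adjoint (X * M * X)"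
    by (simp_all add: mat_adjoint_mult_dim mult_mat_assoc_dim)
  moreover have "mat_adjoint M * mat_adjoint X = X * M" "mat_adjoint X * mat_adjoint M = M * X"
    using X(3,4) by (simp_all add: mat_adjoint_mult_dim)
  ultimately show ?thesis
    using X carrier_matI[OF dims(1,2)] by (simp add: is_moore_penrose_def)
qed

text \<open>With \<open>Z * N\<close> the identity, three of the four Penrose equations are
  immediate.\<close>

lemma is_moore_penrose_if_left_inverse:
  assumes N: "N \<in> carrier_mat n r" and Z: "Z \<in> carrier_mat r n"
    and "Z * N = 1\<^sub>m r" and "mat_adjoint (N * Z) = N * Z"
  shows "is_moore_penrose N Z"
  using assms by (simp add: is_moore_penrose_def)

context
  fixes N :: "complex mat" and n r :: nat
  assumes N: "N \<in> carrier_mat n r" and rank: "vec_space.rank n N = r"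
begin

lemma gram_inv:
  "mat_inv (mat_adjoint N * N) \<in> carrier_mat r r"
  "mat_inv (mat_adjoint N * N) * (mat_adjoint N * N) = 1\<^sub>m r"
  "mat_adjoint (mat_inv (mat_adjoint N * N)) = mat_inv (mat_adjoint N * N)"
proof -
  have G: "mat_adjoint N * N \<in> carrier_mat r r"
    using N by simp
  show "mat_inv (mat_adjoint N * N) \<in> carrier_mat r r"
    "mat_inv (mat_adjoint N * N) * (mat_adjoint N * N) = 1\<^sub>m r"
    using mat_inv_mult[OF G gram_det_nonzero[OF N rank]] by simp_all
  show "mat_adjoint (mat_inv (mat_adjoint N * N)) = mat_inv (mat_adjoint N * N)"
    by (rule mat_inv_hermitian[OF G gram_det_nonzero[OF N rank]]) (simp add: mat_adjoint_mult_dim)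
qed

lemma full_rank_left_inverse: "mat_inv (mat_adjoint N * N) * mat_adjoint N * N = 1\<^sub>m r"
  using gram_inv(1,2) N by (simp add: mult_mat_assoc_dim)

text \<open>This left inverse of \<open>N\<close> makes the product in the other order Hermitian,
  because the inverse of the Gram matrix is Hermitian.\<close>

lemma is_moore_penrose_full_rank:
  "is_moore_penrose N (mat_inv (mat_adjoint N * N) * mat_adjoint N)"
proof (rule is_moore_penrose_if_left_inverse[OF N])
  show "mat_inv (mat_adjoint N * N) * mat_adjoint N \<in> carrier_mat r n"
    using mult_carrier_mat[OF gram_inv(1)] N by simp
  show "mat_inv (mat_adjoint N * N) * mat_adjoint N * N = 1\<^sub>m r"
    by (rule full_rank_left_inverse)
  have [simp]: "dim_row (mat_inv (mat_adjoint N * N)) = dim_col N"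
    "dim_col (mat_inv (mat_adjoint N * N)) = dim_col N"
    using gram_inv(1) N by simp_all
  show "mat_adjoint (N * (mat_inv (mat_adjoint N * N) * mat_adjoint N)) =
      N * (mat_inv (mat_adjoint N * N) * mat_adjoint N)"
    by (simp add: mat_adjoint_mult_dim gram_inv(3) mult_mat_assoc_dim)
qed

end

lemma moore_penrose_full_column_rank:
  assumes "N \<in> carrier_mat n r" and "vec_space.rank n N = r"
  shows "moore_penrose N = mat_inv (mat_adjoint N * N) * mat_adjoint N"
  using is_moore_penrose_full_rank[OF assms] by (rule moore_penrose_eqI)

text \<open>The adjoint of \<open>Q\<close> has full column rank; take adjoints in the preceding
  case.\<close>

lemma is_moore_penrose_full_row_rank:
  assumes Q: "Q \<in> carrier_mat r m" and rank: "vec_space.rank r Q = r"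
  shows "is_moore_penrose Q (mat_adjoint Q * mat_inv (Q * mat_adjoint Q))"
proof -
  have N: "mat_adjoint Q \<in> carrier_mat m r" "vec_space.rank m (mat_adjoint Q) = r"
    using Q rank rank_mat_adjoint[OF Q] by simp_all
  have "mat_adjoint (mat_inv (Q * mat_adjoint Q) * Q) = mat_adjoint Q * mat_inv (Q * mat_adjoint Q)"
    using gram_inv[OF N] Q by (simp add: mat_adjoint_mult_dim)
  then show ?thesis
    using is_moore_penrose_adjoint[OF is_moore_penrose_full_rank[OF N]] by simp
qed

section \<open>The weighted inverses in terms of Moore-Penrose inverses\<close>

lemma weighted_123_inverses_iff:
  assumes A: "A \<in> carrier_mat m n" and W: "W \<in> carrier_mat n m"
    and r: "r = vec_space.rank m A"
  shows "X \<in> weighted_123_inverses A W \<longleftrightarrow>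
    (\<exists>Y \<in> carrier_mat m r. vec_space.rank m Y = r \<and> vec_space.rank n (W * A * W * Y) = r \<and>
       X = Y * moore_penrose (W * A * W * Y))" (is "?L \<longleftrightarrow> ?R")
proof
  have M: "W * A * W \<in> carrier_mat n m"
    using A W by simp
  have dims [simp]: "dim_row A = m" "dim_col A = n" "dim_row W = n" "dim_col W = m"
    using A W by auto
  {
    assume ?L
    then have X: "X \<in> carrier_mat m n" and eqs: "A * W * X * W * A = A" "X * W * A * W * X = X"
      and herm: "mat_adjoint (W * A * W * X) = W * A * W * X"
      by (auto simp: weighted_123_inverses_def)
    have [simp]: "dim_row X = m" "dim_col X = n"
      using X by auto
    \<comment> \<open>Each of \<open>A\<close> and \<open>X\<close> is a product containing the
      other, by AWXWA = A and XWAWX = X, so their ranks agree.\<close>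
    have "vec_space.rank m (A * W * (X * (W * A))) \<le> vec_space.rank m (X * (W * A))"
      by (rule rank_mult_le_right[of _ m m _ n]; rule carrier_matI; simp)
    also have "\<dots> \<le> vec_space.rank m X"
      by (rule rank_mult_le_left[of _ m n _ n]; rule carrier_matI; simp)
    finally have "r \<le> vec_space.rank m X"
      using eqs(1) by (simp add: r mult_mat_assoc_dim)
    moreover have "vec_space.rank m (X * W * (A * (W * X))) \<le> vec_space.rank m (A * (W * X))"
      by (rule rank_mult_le_right[of _ m m _ n]; rule carrier_matI; simp)
    moreover have "vec_space.rank m (A * (W * X)) \<le> r"
      unfolding r by (rule rank_mult_le_left[of _ m n _ n]; rule carrier_matI; simp)
    ultimately have rankX: "vec_space.rank m X = r"
      using eqs(2) by (simp add: mult_mat_assoc_dim)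
    obtain Y Z where Y: "Y \<in> carrier_mat m r" and Z: "Z \<in> carrier_mat r n" and XYZ: "X = Y * Z"
      using vec_space.rank_factorization[OF X] rankX by metis
    have [simp]: "dim_row Y = m" "dim_col Y = r" "dim_row Z = r" "dim_col Z = n"
      using Y Z by auto
    have rankY: "vec_space.rank m Y = r"
      using rank_mult_le_left[OF Y Z] vec_space.rank_le_nc[OF Y] rankX XYZ by simp
    have rankZ: "vec_space.rank r Z = r"
    proof (rule antisym)
      \<comment> \<open>\<open>rank_le_nc\<close> counts columns, so the bound by the
        \<open>r\<close> rows of \<open>Z\<close> is obtained from its adjoint.\<close>
      show "vec_space.rank r Z \<le> r"
        using rank_mat_adjoint[OF Z] vec_space.rank_le_nc[of "mat_adjoint Z" n r] Z by simp
      show "r \<le> vec_space.rank r Z"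
        using rank_mult_le_right[OF Y Z] rankX XYZ by simp
    qed
    define L where "L = mat_inv (mat_adjoint Y * Y) * mat_adjoint Y"
    have L [simp]: "L * Y = 1\<^sub>m r" "dim_row L = r" "dim_col L = m"
      using full_rank_left_inverse[OF Y rankY] gram_inv(1)[OF Y rankY] by (simp_all add: L_def)
    obtain K where K [simp]: "Z * K = 1\<^sub>m r" "dim_row K = n" "dim_col K = r"
    proof -
      have Zadj: "mat_adjoint Z \<in> carrier_mat n r" "vec_space.rank n (mat_adjoint Z) = r"
        using Z rank_mat_adjoint[OF Z] rankZ by simp_all
      \<comment> \<open>\<open>?K\<close> is the Gram left inverse of \<open>mat_adjoint Z\<close>;
        its adjoint is the required right inverse of \<open>Z\<close>.\<close>
      let ?K = "mat_inv (Z * mat_adjoint Z) * Z"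
      have [simp]: "dim_row (mat_inv (Z * mat_adjoint Z)) = r" "dim_col (mat_inv (Z * mat_adjoint Z)) = r"
        using carrier_matD[OF gram_inv(1)[OF Zadj]] by simp_all
      have "?K * mat_adjoint Z = 1\<^sub>m r"
        using full_rank_left_inverse[OF Zadj] by simp
      from arg_cong[OF this, of mat_adjoint] have "Z * mat_adjoint ?K = 1\<^sub>m r"
        by (subst (asm) mat_adjoint_mult_dim) simp_all
      then show thesis
        by (rule that) simp_all
    qed
    let ?N = "W * A * W * Y"
    have N: "?N \<in> carrier_mat n r"
      using M Y by simp
    have LX: "L * X = Z" and XK: "X * K = Y"
      using Y Z by (simp_all add: XYZ mult_mat_assoc_dim) (simp add: mult_mat_assoc_dim[symmetric])
    \<comment> \<open>Multiplying XWAWX = X by \<open>L\<close> on the left and \<open>K\<close> on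
      the right cancels the outer factors: the left side becomes \<open>Z * ?N\<close>, the right
      side the identity.\<close>
    have "L * (X * W * A * W * X) * K = L * X * K"
      by (simp only: eqs(2))
    also have "L * X * K = 1\<^sub>m r"
      by (simp add: LX)
    also have "L * (X * W * A * W * X) * K = (L * X) * (W * A * W * (X * K))"
      by (simp add: mult_mat_assoc_dim)
    also have "\<dots> = Z * ?N"
      by (simp only: LX XK)
    finally have ZN: "Z * ?N = 1\<^sub>m r" .
    have "is_moore_penrose ?N Z"
      using is_moore_penrose_if_left_inverse[OF N Z ZN] herm by (simp add: XYZ mult_mat_assoc_dim)
    then have "X = Y * moore_penrose ?N"
      using XYZ by (simp add: moore_penrose_eqI)
    then show ?R
      using Y rankY rank_if_left_inverse[OF N Z ZN] by blast
  }
  {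
    assume ?R
    then obtain Y where Y: "Y \<in> carrier_mat m r" and rankN: "vec_space.rank n (W * A * W * Y) = r"
      and X: "X = Y * moore_penrose (W * A * W * Y)"
      by blast
    let ?N = "W * A * W * Y"
    define Z where "Z = moore_penrose ?N"
    have N: "?N \<in> carrier_mat n r"
      using M Y by simp
    have mp: "is_moore_penrose ?N Z"
      using is_moore_penrose_full_rank[OF N rankN] moore_penrose_full_column_rank[OF N rankN]
      by (simp add: Z_def)
    then have Z: "Z \<in> carrier_mat r n" and herm: "mat_adjoint (?N * Z) = ?N * Z"
      using N Y by (auto simp: is_moore_penrose_def)
    have ZN: "Z * ?N = 1\<^sub>m r"
      using full_rank_left_inverse[OF N rankN] moore_penrose_full_column_rank[OF N rankN]
      by (simp add: Z_def)
    obtain B D where B: "B \<in> carrier_mat m r" and D: "D \<in> carrier_mat r n" and ABD: "A = B * D"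
      using vec_space.rank_factorization[OF A] r by metis
    have [simp]: "dim_row Y = m" "dim_col Y = r" "dim_row Z = r" "dim_col Z = n"
      "dim_row B = m" "dim_col B = r" "dim_row D = r" "dim_col D = n"
      using Y Z B D by auto
    have XYZ: "X = Y * Z"
      by (simp add: X Z_def)
    have E: "D * (W * Y) \<in> carrier_mat r r" and F: "Z * (W * B) \<in> carrier_mat r r"
      by (rule carrier_matI; simp)+
    have "(Z * (W * B)) * (D * (W * Y)) = Z * ?N"
      by (simp add: ABD mult_mat_assoc_dim)
    \<comment> \<open>Both factors are square because \<open>Y\<close> has as many columns as the
      inner dimension r(A) of \<open>B * D\<close>, so the one-sided inverse is two-sided.\<close>
    then have "(D * (W * Y)) * (Z * (W * B)) = 1\<^sub>m r"
      unfolding ZN by (rule mat_mult_left_right_inverse[OF F E])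
    then have "B * ((D * (W * Y)) * (Z * (W * B))) * D = A"
      by (simp only: right_mult_one_mat[OF B] ABD)
    moreover have "B * ((D * (W * Y)) * (Z * (W * B))) * D = A * W * X * W * A"
      by (simp add: XYZ ABD mult_mat_assoc_dim)
    ultimately have "A * W * X * W * A = A"
      by simp
    moreover have "X * W * A * W * X = X"
    proof -
      have "X * W * A * W * X = Y * (Z * ?N) * Z"
        by (simp add: XYZ mult_mat_assoc_dim)
      then show ?thesis
        by (simp only: ZN right_mult_one_mat[OF Y] XYZ)
    qed
    moreover have "mat_adjoint (W * A * W * X) = W * A * W * X"
      using herm by (simp add: XYZ mult_mat_assoc_dim)
    moreover have "X \<in> carrier_mat m n"
      unfolding XYZ using Y Z by (rule mult_carrier_mat)
    ultimately show ?L
      by (simp add: weighted_123_inverses_def)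
  }
qed

text \<open>The adjoint reverses products: the first two equations keep their shape, and the
  Hermitian condition on XWAW becomes the one that \<open>weighted_123_inverses\<close> imposes on
  the adjoint matrices.\<close>

lemma weighted_124_inverses_adjoint:
  assumes A: "A \<in> carrier_mat m n" and W: "W \<in> carrier_mat n m"
  shows "X \<in> weighted_124_inverses A W \<longleftrightarrow>
    mat_adjoint X \<in> weighted_123_inverses (mat_adjoint A) (mat_adjoint W)"
proof (cases "X \<in> carrier_mat m n")
  case True
  have [simp]: "dim_row A = m" "dim_col A = n" "dim_row W = n" "dim_col W = m"
    "dim_row X = m" "dim_col X = n"
    using A W True by auto
  have "mat_adjoint A * mat_adjoint W * mat_adjoint X * mat_adjoint W * mat_adjoint A =
      mat_adjoint (A * W * X * W * A)"
    "mat_adjoint X * mat_adjoint W * mat_adjoint A * mat_adjoint W * mat_adjoint X =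
      mat_adjoint (X * W * A * W * X)"
    "mat_adjoint W * mat_adjoint A * mat_adjoint W * mat_adjoint X = mat_adjoint (X * W * A * W)"
    by (simp_all add: mat_adjoint_mult_dim mult_mat_assoc_dim)
  moreover have "mat_adjoint S = mat_adjoint T \<longleftrightarrow> S = T" for S T :: "complex mat"
    by (metis mat_adjoint_adjoint)
  ultimately show ?thesis
    using True by (auto simp: weighted_123_inverses_def weighted_124_inverses_def)
next
  case False
  then show ?thesis
    using A by (simp add: weighted_123_inverses_def weighted_124_inverses_def)
qed

lemma weighted_124_inverses_iff:
  assumes A: "A \<in> carrier_mat m n" and W: "W \<in> carrier_mat n m"
    and r: "r = vec_space.rank m A"
  shows "X \<in> weighted_124_inverses A W \<longleftrightarrow>
    (\<exists>Y \<in> carrier_mat r n. vec_space.rank r Y = r \<and> vec_space.rank r (Y * W * A * W) = r \<and>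
       X = moore_penrose (Y * W * A * W) * Y)" (is "_ \<longleftrightarrow> (\<exists>Y \<in> _. ?Q Y)")
proof -
  let ?A = "mat_adjoint A" and ?W = "mat_adjoint W"
  let ?P = "\<lambda>Y :: complex mat. vec_space.rank n Y = r \<and> vec_space.rank m (?W * ?A * ?W * Y) = r \<and>
     mat_adjoint X = Y * moore_penrose (?W * ?A * ?W * Y)"
  have [simp]: "dim_row A = m" "dim_col A = n" "dim_row W = n" "dim_col W = m"
    using A W by auto
  have "X \<in> weighted_124_inverses A W \<longleftrightarrow> (\<exists>Y \<in> carrier_mat n r. ?P Y)"
    unfolding weighted_124_inverses_adjoint[OF A W]
    using A W rank_mat_adjoint[OF A] r by (intro weighted_123_inverses_iff) auto
  \<comment> \<open>Reindex the witnesses by the involution \<open>mat_adjoint\<close>.\<close>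
  also have "\<dots> \<longleftrightarrow> (\<exists>Y \<in> carrier_mat r n. ?P (mat_adjoint Y))"
    by (metis mat_adjoint_adjoint mat_adjoint_carrier)
  also have "\<dots> \<longleftrightarrow> (\<exists>Y \<in> carrier_mat r n. ?Q Y)"
  proof (rule bex_cong[OF refl])
    fix Y :: "complex mat" assume Y: "Y \<in> carrier_mat r n"
    then have [simp]: "dim_row Y = r" "dim_col Y = n" by auto
    let ?N = "Y * W * A * W"
    have N: "?N \<in> carrier_mat r m"
    using mult_carrier_mat[OF mult_carrier_mat[OF mult_carrier_mat[OF Y W] A] W] .
    have adj: "?W * ?A * ?W * mat_adjoint Y = mat_adjoint ?N"
      by (simp add: mat_adjoint_mult_dim mult_mat_assoc_dim)
    \<comment> \<open>The rank condition, common to both sides, supplies an actual Moore-Penrose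
      inverse of \<open>?N\<close>, so that \<open>moore_penrose\<close> commutes with the adjoint
      here.\<close>
    have "mat_adjoint X = mat_adjoint Y * moore_penrose (mat_adjoint ?N) \<longleftrightarrow>
        X = moore_penrose ?N * Y" if rankN: "vec_space.rank r ?N = r"
    proof -
      have mp: "is_moore_penrose ?N (moore_penrose ?N)"
        using is_moore_penrose_full_row_rank[OF N rankN] moore_penrose_eqI by metis
      then have "moore_penrose (mat_adjoint ?N) = mat_adjoint (moore_penrose ?N)"
        by (intro moore_penrose_eqI is_moore_penrose_adjoint)
      moreover have "moore_penrose ?N \<in> carrier_mat m r"
        using mp by (simp add: is_moore_penrose_def)
      then have "dim_col (moore_penrose ?N) = r"
        by (rule carrier_matD(2))
      ultimately have "mat_adjoint Y * moore_penrose (mat_adjoint ?N) =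
          mat_adjoint (moore_penrose ?N * Y)"
        by (simp add: mat_adjoint_mult_dim)
      then show ?thesis
        by (metis mat_adjoint_adjoint)
    qed
    then show "?P (mat_adjoint Y) \<longleftrightarrow> ?Q Y"
      unfolding adj rank_mat_adjoint[OF N] rank_mat_adjoint[OF Y] by blast
  qed
  finally show ?thesis .
qed

section \<open>Explicit inverse formulas and the existence of those inverses\<close>

theorem theorem2p5:
  fixes A W :: "complex mat" and m n r :: nat
  assumes "A \<in> carrier_mat m n"
    and "W \<in> carrier_mat n m"
    and "r = mat_rank A"
  shows
    "weighted_123_inverses A W =
       {Y * mat_inv (mat_adjoint (W * A * W * Y) * (W * A * W * Y)) * mat_adjoint (W * A * W * Y) | Y.
          Y \<in> carrier_mat_rank m r r \<and>
          mat_rank (W * A * W * Y) = mat_rank Y \<and> mat_rank Y = mat_rank A} \<and>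
     weighted_123_inverses A W =
       {Y * moore_penrose (W * A * W * Y) | Y.
          Y \<in> carrier_mat_rank m r r \<and>
          mat_rank (W * A * W * Y) = mat_rank Y \<and> mat_rank Y = mat_rank A} \<and>
     weighted_124_inverses A W =
       {mat_adjoint (Y * W * A * W) * mat_inv (Y * W * A * W * mat_adjoint (Y * W * A * W)) * Y | Y.
          Y \<in> carrier_mat_rank r n r \<and>
          mat_rank (Y * W * A * W) = mat_rank Y \<and> mat_rank Y = mat_rank A} \<and>
     weighted_124_inverses A W =
       {moore_penrose (Y * W * A * W) * Y | Y.
          Y \<in> carrier_mat_rank r n r \<and>
          mat_rank (Y * W * A * W) = mat_rank Y \<and> mat_rank Y = mat_rank A} \<and>
     \<comment> \<open>the inverses written above exist\<close>
     (\<forall>Y \<in> carrier_mat_rank m r r.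
        mat_rank (W * A * W * Y) = mat_rank Y \<and> mat_rank Y = mat_rank A \<longrightarrow>
        invertible_mat (mat_adjoint (W * A * W * Y) * (W * A * W * Y))) \<and>
     (\<forall>Y \<in> carrier_mat_rank r n r.
        mat_rank (Y * W * A * W) = mat_rank Y \<and> mat_rank Y = mat_rank A \<longrightarrow>
        invertible_mat (Y * W * A * W * mat_adjoint (Y * W * A * W)))"
proof -
  have A: "A \<in> carrier_mat m n" and W: "W \<in> carrier_mat n m" and r: "r = vec_space.rank m A"
    using assms by auto
  define P where "P Y \<longleftrightarrow> Y \<in> carrier_mat_rank m r r \<and>
    mat_rank (W * A * W * Y) = mat_rank Y \<and> mat_rank Y = mat_rank A" for Y
  define Q where "Q Y \<longleftrightarrow> Y \<in> carrier_mat_rank r n r \<and>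
    mat_rank (Y * W * A * W) = mat_rank Y \<and> mat_rank Y = mat_rank A" for Y
  \<comment> \<open>\<open>mat_rank\<close> reads the ambient dimension off its argument. With that
    dimension made explicit, the chain r(WAWY) = r(Y) = r(A) says that both ranks are
    \<open>r\<close>.\<close>
  have P_iff: "P Y \<longleftrightarrow> Y \<in> carrier_mat m r \<and> vec_space.rank m Y = r \<and>
      vec_space.rank n (W * A * W * Y) = r" for Y
    using A W by (auto simp: P_def carrier_mat_rank_def r)
  have Q_iff: "Q Y \<longleftrightarrow> Y \<in> carrier_mat r n \<and> vec_space.rank r Y = r \<and>
      vec_space.rank r (Y * W * A * W) = r" for Y
    using A W by (auto simp: Q_def carrier_mat_rank_def r)
  have P_carrier: "W * A * W * Y \<in> carrier_mat n r" if "P Y" for Y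
    using that A W by (auto simp: P_iff)
  have Q_carrier: "Y * W * A * W \<in> carrier_mat r m" if "Q Y" for Y
    using that A W by (auto simp: Q_iff)
  have Q_adjoint: "mat_adjoint (Y * W * A * W) \<in> carrier_mat m r"
    "vec_space.rank m (mat_adjoint (Y * W * A * W)) = r" if "Q Y" for Y
    using Q_carrier[OF that] rank_mat_adjoint[OF Q_carrier[OF that]] that by (simp_all add: Q_iff)
  have P_eq: "Y * mat_inv (mat_adjoint (W * A * W * Y) * (W * A * W * Y)) * mat_adjoint (W * A * W * Y)
      = Y * moore_penrose (W * A * W * Y)" if "P Y" for Y
  proof -
    have Y: "Y \<in> carrier_mat m r" and rank: "vec_space.rank n (W * A * W * Y) = r"
      using that by (auto simp: P_iff)
    have "mat_adjoint (W * A * W * Y) \<in> carrier_mat r n"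
      using P_carrier[OF that] by simp
    then show ?thesis
      unfolding moore_penrose_full_column_rank[OF P_carrier[OF that] rank]
      by (rule assoc_mult_mat[OF Y gram_inv(1)[OF P_carrier[OF that] rank]])
  qed
  have Q_eq: "mat_adjoint (Y * W * A * W) * mat_inv (Y * W * A * W * mat_adjoint (Y * W * A * W)) * Y
      = moore_penrose (Y * W * A * W) * Y" if "Q Y" for Y
    using moore_penrose_eqI[OF is_moore_penrose_full_row_rank[OF Q_carrier[OF that]]] that
    by (simp add: Q_iff)
  have 123: "weighted_123_inverses A W = {Y * moore_penrose (W * A * W * Y) | Y. P Y}"
    using weighted_123_inverses_iff[OF A W r] by (auto simp: P_iff)
  have 124: "weighted_124_inverses A W = {moore_penrose (Y * W * A * W) * Y | Y. Q Y}"
    using weighted_124_inverses_iff[OF A W r] by (auto simp: Q_iff)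
  have "invertible_mat (mat_adjoint (W * A * W * Y) * (W * A * W * Y))" if "P Y" for Y
    using P_carrier[OF that] that
    by (intro invertible_mat_if_det_nonzero[of _ r] gram_det_nonzero[of _ n r]) (auto simp: P_iff)
  moreover have "invertible_mat (Y * W * A * W * mat_adjoint (Y * W * A * W))" if "Q Y" for Y
  proof (rule invertible_mat_if_det_nonzero)
    show "Y * W * A * W * mat_adjoint (Y * W * A * W) \<in> carrier_mat r r"
      using mult_carrier_mat[OF Q_carrier[OF that] iffD2[OF mat_adjoint_carrier Q_carrier[OF that]]] .
    \<comment> \<open>This product is the Gram matrix of \<open>mat_adjoint (Y * W * A * W)\<close>,
      which has full column rank.\<close>
    show "det (Y * W * A * W * mat_adjoint (Y * W * A * W)) \<noteq> 0"
      using gram_det_nonzero[OF Q_adjoint[OF that]] by simp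
  qed
  moreover have "weighted_123_inverses A W =
      {Y * mat_inv (mat_adjoint (W * A * W * Y) * (W * A * W * Y)) * mat_adjoint (W * A * W * Y) | Y. P Y}"
    unfolding 123 using P_eq by (metis (lifting))
  moreover have "weighted_124_inverses A W =
      {mat_adjoint (Y * W * A * W) * mat_inv (Y * W * A * W * mat_adjoint (Y * W * A * W)) * Y | Y. Q Y}"
    unfolding 124 using Q_eq by (metis (lifting))
  ultimately show ?thesis
    using 123 124 unfolding P_def Q_def by blast
qed

end
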